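(* Let $\mathcal X$ be a Polish space and $\mu\in\mathcal P(\mathcal X)$. Let $\mathcal F$ be a vector space of measurable functions $\mathcal X\to\mathbb R$ such that $\int_{\mathcal X}e^{\varphi}\,d\mu<\infty$ for all $\varphi\in\mathcal F$, and let $\Phi$ be a set of couples $(\psi,\varphi)$ of continuous functions with $(0,0)\in\Phi\subset\mathcal F\times\mathcal F$. Then any deviation function $\alpha$ for $\mathcal T$ that belongs to the class $\mathcal C$ is a transportation function for $\mathcal T$ in $\mathcal P_{\mathcal F}$.
   Context: $\mathcal P(\mathcal X)$ is the set of Borel probability measures on $\mathcal X$. $H(\nu\mid\mu)=\int\log\frac{d\nu}{d\mu}\,d\nu$ if $\nu\ll\mu$ and $+\infty$ otherwise. $\mathcal P_{\mathcal F}=\{\nu\in\mathcal P(\mathcal X):\int|\varphi|\,d\nu<\infty\ \forall\varphi\in\mathcal F\}$. For $\nu\in\mathcal P_{\mathcal F}$, $\mathcal T(\nu)=\sup_{(\psi,\varphi)\in\Phi}\{\int\psi\,d\mu+\int\varphi\,d\nu\}\in[0,\infty]$. $L_n=\frac1n\sum_{i=1}^n\delta_{X_i}$, with $(X_i)_{i\ge1}$ i.i.d. of law $\mu$. "Increasing" means nondecreasing. $\mathcal C$ is the class of all functions $\alpha$ on $[0,\infty)$ with values in $[0,\infty]$ that are convex, increasing, left continuous, with $\alpha(0)=0$. A left continuous increasing function $\alpha:[0,\infty)\to[0,\infty]$ (with $\alpha(+\infty)=\lim_{t\to\infty}\alpha(t)$) is a transportation function for $\mathcal T$ in $\mathcal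 P_{\mathcal F}$ if $\alpha(\mathcal T(\nu))\le H(\nu\mid\mu)$ for all $\nu\in\mathcal P_{\mathcal F}$; it is a deviation function for $\mathcal T$ if $\limsup_{n\to\infty}\frac1n\log\mathbb P(\mathcal T(L_n)\ge t)\le-\alpha(t)$ for all $t\ge0$. *)

theory Defs
  imports "HOL-Probability.Probability"
begin

definition borel_prob :: "'a::topological_space measure set" where
  "borel_prob = {\<nu>. prob_space \<nu> \<and> sets \<nu> = sets borel}"

text \<open>
  The negative part of \<open>ln (d\<nu>/d\<mu>)\<close> is always \<open>\<nu>\<close>-integrable when \<open>\<nu>\<close> is absolutely continuous
  with respect to the probability measure \<open>\<mu>\<close> (because \<open>t * ln t \<ge> - 1 / e\<close>). Hence if the
  log-density is not integrable, its integral is \<open>+\<infinity>\<close>, whereas the Bochner integral in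
  \<^const>\<open>KL_divergence\<close> would be \<open>0\<close>. Note also the argument order of \<^const>\<open>KL_divergence\<close>.
\<close>
definition rel_entropy :: "'a measure \<Rightarrow> 'a measure \<Rightarrow> ereal" where
  "rel_entropy \<nu> \<mu> =
     (if absolutely_continuous \<mu> \<nu> \<and> integrable \<nu> (entropy_density (exp 1) \<mu> \<nu>)
      then ereal (KL_divergence (exp 1) \<mu> \<nu>) else \<infinity>)"

definition function_subspace :: "('a \<Rightarrow> real) set \<Rightarrow> bool" where
  "function_subspace \<F> \<longleftrightarrow>
     (\<lambda>_. 0) \<in> \<F> \<and>
     (\<forall>f\<in>\<F>. \<forall>g\<in>\<F>. (\<lambda>x. f x + g x) \<in> \<F>) \<and>
     (\<forall>c. \<forall>f\<in>\<F>. (\<lambda>x. c * f x) \<in> \<F>)"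

definition prob_integrating :: "('a::topological_space \<Rightarrow> real) set \<Rightarrow> 'a measure set" where
  "prob_integrating \<F> = {\<nu> \<in> borel_prob. \<forall>\<phi>\<in>\<F>. integrable \<nu> \<phi>}"

definition transport_cost ::
    "'a measure \<Rightarrow> (('a \<Rightarrow> real) \<times> ('a \<Rightarrow> real)) set \<Rightarrow> 'a measure \<Rightarrow> ereal" where
  "transport_cost \<mu> \<Phi> \<nu> = (SUP (\<psi>, \<phi>)\<in>\<Phi>. ereal ((\<integral>x. \<psi> x \<partial>\<mu>) + (\<integral>x. \<phi> x \<partial>\<nu>)))"

definition empirical_measure :: "nat \<Rightarrow> (nat \<Rightarrow> 'a::topological_space) \<Rightarrow> 'a measure" where
  "empirical_measure n x =
     measure_of UNIV (sets borel)
       (\<lambda>A. ennreal (1 / real n) * (\<Sum>i=1..n. emeasure (return borel (x i)) A))"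

lemma sets_empirical_measure: "sets (empirical_measure n x) = sets borel"
  unfolding empirical_measure_def using sets.sigma_sets_eq[of borel] by (simp add: sets_measure_of)

lemma emeasure_empirical_measure:
  assumes "A \<in> sets borel"
  shows "emeasure (empirical_measure n x) A =
           ennreal (1 / real n) * (\<Sum>i=1..n. emeasure (return borel (x i)) A)"
proof (rule emeasure_measure_of[OF empirical_measure_def])
  show "countably_additive (sets (empirical_measure n x))
     (\<lambda>A. ennreal (1 / real n) * (\<Sum>i=1..n. emeasure (return borel (x i)) A))"
  proof (rule countably_additiveI)
    fix B :: "nat \<Rightarrow> 'a set"
    assume B: "range B \<subseteq> sets (empirical_measure n x)" "disjoint_family B"
    then have "(\<Sum>k. emeasure (return borel (x i)) (B k)) = emeasure (return borel (x i)) (\<Union>(range B))"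
      for i by (intro suminf_emeasure) (auto simp: sets_empirical_measure)
    then show "(\<Sum>k. ennreal (1 / real n) * (\<Sum>i=1..n. emeasure (return borel (x i)) (B k))) =
        ennreal (1 / real n) * (\<Sum>i=1..n. emeasure (return borel (x i)) (\<Union>(range B)))"
      by (simp add: suminf_sum)
  qed
qed (auto simp: positive_def sets_empirical_measure assms)

text \<open>
  Functions \<open>[0,\<infinity>) \<rightarrow> [0,\<infinity>]\<close> are represented by functions \<open>real \<Rightarrow> ereal\<close>
  of which only the values on \<open>{0..}\<close> matter.
\<close>
definition left_cont_increasing :: "(real \<Rightarrow> ereal) \<Rightarrow> bool" where
  "left_cont_increasing \<alpha> \<longleftrightarrow>
     (\<forall>t\<ge>0. 0 \<le> \<alpha> t) \<and> mono_on {0..} \<alpha> \<and> (\<forall>t>0. continuous (at_left t) \<alpha>)"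

definition class_C :: "(real \<Rightarrow> ereal) set" where
  "class_C = {\<alpha>. left_cont_increasing \<alpha> \<and> \<alpha> 0 = 0 \<and>
     (\<forall>s\<ge>0. \<forall>t\<ge>0. \<forall>u\<in>{0..1}.
        \<alpha> ((1 - u) * s + u * t) \<le> ereal (1 - u) * \<alpha> s + ereal u * \<alpha> t)}"

definition extend_top :: "(real \<Rightarrow> ereal) \<Rightarrow> ereal \<Rightarrow> ereal" where
  "extend_top \<alpha> s = (if s = \<infinity> then Lim at_top \<alpha> else \<alpha> (real_of_ereal s))"

definition transportation_function ::
    "'a::topological_space measure \<Rightarrow> ('a \<Rightarrow> real) set \<Rightarrow> (('a \<Rightarrow> real) \<times> ('a \<Rightarrow> real)) set \<Rightarrow>
     (real \<Rightarrow> ereal) \<Rightarrow> bool" where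
  "transportation_function \<mu> \<F> \<Phi> \<alpha> \<longleftrightarrow>
     left_cont_increasing \<alpha> \<and>
     (\<forall>\<nu>\<in>prob_integrating \<F>. extend_top \<alpha> (transport_cost \<mu> \<Phi> \<nu>) \<le> rel_entropy \<nu> \<mu>)"

definition ext_ln :: "real \<Rightarrow> ereal" where
  "ext_ln p = (if p = 0 then - \<infinity> else ereal (ln p))"

definition iid_sequence ::
    "'w measure \<Rightarrow> (nat \<Rightarrow> 'w \<Rightarrow> 'a::topological_space) \<Rightarrow> 'a measure \<Rightarrow> bool" where
  "iid_sequence P X \<mu> \<longleftrightarrow>
     prob_space P \<and> prob_space.indep_vars P (\<lambda>_. borel) X {1..} \<and> (\<forall>i\<ge>1. distr P borel (X i) = \<mu>)"

definition deviation_function ::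
    "'w measure \<Rightarrow> (nat \<Rightarrow> 'w \<Rightarrow> 'a::topological_space) \<Rightarrow>
     'a measure \<Rightarrow> (('a \<Rightarrow> real) \<times> ('a \<Rightarrow> real)) set \<Rightarrow> (real \<Rightarrow> ereal) \<Rightarrow> bool" where
  "deviation_function P X \<mu> \<Phi> \<alpha> \<longleftrightarrow>
     left_cont_increasing \<alpha> \<and>
     (\<forall>t\<ge>0. limsup (\<lambda>n. ereal (1 / real n) *
          ext_ln (measure P {\<omega> \<in> space P.
            ereal t \<le> transport_cost \<mu> \<Phi> (empirical_measure n (\<lambda>i. X i \<omega>))}))
        \<le> - \<alpha> t)"

end

theory Submission
  imports Defs
begin

text \<open>
  The proof is the change of measure behind the lower bound of large deviation theory. Let \<open>\<nu>\<close> have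
  finite relative entropy \<open>H\<close> with respect to \<open>\<mu>\<close>, let \<open>f\<close> be its density, and let \<open>t\<close> be a real number
  strictly below the transport cost of \<open>\<nu>\<close>. One pair \<open>(\<psi>, \<phi>)\<close> already witnesses this:
  \<open>\<integral>\<psi> d\<mu> + \<integral>\<phi> d\<nu> > t\<close>. Under the tilted law \<open>dQ = \<Prod> f(X\<^sub>i) dP\<close> the first \<open>n\<close> observations are
  independent with law \<open>\<nu>\<close> (\<open>tilted_iid\<close>), so by the weak law of large numbers the empirical mean of
  \<open>\<phi>\<close> is close to \<open>\<integral>\<phi> d\<nu>\<close>, which forces the transport cost of the empirical measure above \<open>t\<close>, while
  the empirical mean of \<open>ln f\<close> is close to \<open>H\<close>, so that the density of \<open>Q\<close> is at most
  \<open>exp (n (H + \<epsilon>))\<close>. Undoing the tilt, an event of \<open>Q\<close>-probability at least \<open>1/2\<close> has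
  \<open>P\<close>-probability at least \<open>exp (- n (H + \<epsilon>)) / 2\<close> (\<open>eventually_prob_ge_of_tilting\<close>). Compared with
  the upper bound \<open>- \<alpha>(t)\<close> that defines a deviation function, this gives \<open>\<alpha>(t) \<le> H\<close>, and left
  continuity of \<open>\<alpha>\<close> carries the inequality up to the transport cost itself (\<open>extend_top_le\<close>).

  Two points need care. The functions \<open>\<phi>\<close> and \<open>ln f\<close> are only known to be \<open>\<nu>\<close>-integrable, so the weak
  law is proved for integrable observables, by truncation. And the event that the transport cost of
  the empirical measure is at least \<open>t\<close> involves a supremum over a possibly uncountable family; it
  is measurable because the members of the family are continuous functions of the sample
  (\<open>sets_transport_cost_empirical_ge\<close>).
\<close>

section \<open>A weak law of large numbers for integrable observables\<close>

lemma (in prob_space) square_sum_indep_centered: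
  fixes Y :: "'i \<Rightarrow> 'a \<Rightarrow> real"
  assumes "finite I" "indep_vars (\<lambda>_. borel) Y I"
    and "\<And>i. i \<in> I \<Longrightarrow> integrable M (\<lambda>\<omega>. (Y i \<omega>)\<^sup>2)"
    and "\<And>i. i \<in> I \<Longrightarrow> expectation (Y i) = 0"
  shows "integrable M (\<lambda>\<omega>. (\<Sum>i\<in>I. Y i \<omega>)\<^sup>2)"
    and "expectation (\<lambda>\<omega>. (\<Sum>i\<in>I. Y i \<omega>)\<^sup>2) = (\<Sum>i\<in>I. expectation (\<lambda>\<omega>. (Y i \<omega>)\<^sup>2))"
proof -
  have "integrable M (\<lambda>\<omega>. (\<Sum>i\<in>I. Y i \<omega>)\<^sup>2) \<and>
    expectation (\<lambda>\<omega>. (\<Sum>i\<in>I. Y i \<omega>)\<^sup>2) = (\<Sum>i\<in>I. expectation (\<lambda>\<omega>. (Y i \<omega>)\<^sup>2))"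
    using assms
  proof (induction I rule: finite_induct)
    case empty
    then show ?case by simp
  next
    case (insert j J)
    define S where "S = (\<lambda>\<omega>. \<Sum>i\<in>J. Y i \<omega>)"
    have rv: "Y i \<in> borel_measurable M" if "i \<in> insert j J" for i
      using insert.prems(1) that by (auto simp: indep_vars_def)
    have int: "integrable M (Y i)" if "i \<in> insert j J" for i
      using square_integrable_imp_integrable[OF rv[OF that] insert.prems(2)[OF that]] .
    have "indep_vars (\<lambda>_. borel) Y J"
      using insert.prems(1) by (rule indep_vars_subset) auto
    then have IH: "integrable M (\<lambda>\<omega>. (S \<omega>)\<^sup>2)"
      "expectation (\<lambda>\<omega>. (S \<omega>)\<^sup>2) = (\<Sum>i\<in>J. expectation (\<lambda>\<omega>. (Y i \<omega>)\<^sup>2))"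
      using insert.IH insert.prems unfolding S_def by auto
    have intS: "integrable M S"
      unfolding S_def using int by auto
    have ind: "indep_var borel (Y j) borel S"
      unfolding S_def by (rule indep_vars_sum) (use insert in auto)
    have prod: "integrable M (\<lambda>\<omega>. Y j \<omega> * S \<omega>)" "expectation (\<lambda>\<omega>. Y j \<omega> * S \<omega>) = 0"
      using indep_var_integrable[OF ind int intS] indep_var_lebesgue_integral[OF ind int intS]
        insert.prems(3)[of j] by auto
    have eq: "(\<lambda>\<omega>. (\<Sum>i\<in>insert j J. Y i \<omega>)\<^sup>2) = (\<lambda>\<omega>. (Y j \<omega>)\<^sup>2 + 2 * (Y j \<omega> * S \<omega>) + (S \<omega>)\<^sup>2)"
      using insert.hyps by (auto simp: S_def power2_sum algebra_simps)
    show ?case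
      unfolding eq using insert.hyps insert.prems(2)[of j] prod IH by simp
  qed
  then show "integrable M (\<lambda>\<omega>. (\<Sum>i\<in>I. Y i \<omega>)\<^sup>2)"
    and "expectation (\<lambda>\<omega>. (\<Sum>i\<in>I. Y i \<omega>)\<^sup>2) = (\<Sum>i\<in>I. expectation (\<lambda>\<omega>. (Y i \<omega>)\<^sup>2))"
    by auto
qed

lemma (in prob_space) expectation_abs_le_sqrt:
  fixes Z :: "'a \<Rightarrow> real"
  assumes "Z \<in> borel_measurable M" "integrable M (\<lambda>\<omega>. (Z \<omega>)\<^sup>2)"
  shows "expectation (\<lambda>\<omega>. \<bar>Z \<omega>\<bar>) \<le> sqrt (expectation (\<lambda>\<omega>. (Z \<omega>)\<^sup>2))"
proof -
  have int: "integrable M (\<lambda>\<omega>. \<bar>Z \<omega>\<bar>)"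
    using square_integrable_imp_integrable[OF assms] by auto
  have "0 \<le> variance (\<lambda>\<omega>. \<bar>Z \<omega>\<bar>)"
    by (rule variance_positive)
  also have "\<dots> = expectation (\<lambda>\<omega>. (Z \<omega>)\<^sup>2) - (expectation (\<lambda>\<omega>. \<bar>Z \<omega>\<bar>))\<^sup>2"
    using variance_eq[OF int] assms by simp
  finally show ?thesis by (intro real_le_rsqrt) simp
qed

text \<open>
  Truncate \<open>h\<close> at level \<open>K\<close>. The bounded part has variance at most \<open>K\<^sup>2\<close>, and variances of
  independent variables add up, which gives the term \<open>K \<surd>n\<close> in quadratic and hence in absolute mean.
  The remainder is estimated by the triangle inequality alone; it enters once for the sample and
  once for its mean, hence the factor 2.
\<close>

lemma (in prob_space) iid_mean_abs_deviation_le: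
  fixes h :: "'b \<Rightarrow> real"
  assumes I: "finite I" and ind: "indep_vars (\<lambda>_. N) X I"
    and law: "\<And>i. i \<in> I \<Longrightarrow> distr M N (X i) = D"
    and D: "prob_space D" "sets D = sets N" and h: "integrable D h" and K: "0 \<le> K"
  shows "integrable M (\<lambda>\<omega>. (\<Sum>i\<in>I. h (X i \<omega>)) - card I * (\<integral>y. h y \<partial>D))" (is "integrable M ?Z")
    and "expectation (\<lambda>\<omega>. \<bar>(\<Sum>i\<in>I. h (X i \<omega>)) - card I * (\<integral>y. h y \<partial>D)\<bar>)
      \<le> K * sqrt (card I) + 2 * card I * (\<integral>y. \<bar>h y\<bar> * indicator {y. K < \<bar>h y\<bar>} y \<partial>D)"
proof -
  interpret D: prob_space D by fact
  have X[measurable]: "X i \<in> measurable M N" if "i \<in> I" for i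
    using ind that by (auto simp: indep_vars_def)
  have hN[measurable]: "h \<in> borel_measurable N"
    using h D(2) by (metis borel_measurable_integrable measurable_cong_sets)
  have pull_int: "integrable M (\<lambda>\<omega>. k (X i \<omega>))" and pull_eq: "expectation (\<lambda>\<omega>. k (X i \<omega>)) = (\<integral>y. k y \<partial>D)"
    if "i \<in> I" "integrable D k" for k :: "'b \<Rightarrow> real" and i
  proof -
    have [measurable]: "k \<in> borel_measurable N"
      using that D(2) by (metis borel_measurable_integrable measurable_cong_sets)
    have "integrable (distr M N (X i)) k" using that law by simp
    then show "integrable M (\<lambda>\<omega>. k (X i \<omega>))"
      using that X by (subst (asm) integrable_distr_eq) auto
    show "expectation (\<lambda>\<omega>. k (X i \<omega>)) = (\<integral>y. k y \<partial>D)"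
      using that X by (subst law[symmetric, OF that(1)], subst integral_distr) auto
  qed
  define g where "g = (\<lambda>y. h y * indicator {y. \<bar>h y\<bar> \<le> K} y)"
  define r where "r = (\<lambda>y. h y * indicator {y. K < \<bar>h y\<bar>} y)"
  have h_split: "h y = g y + r y" for y
    by (auto simp: g_def r_def indicator_def)
  have [measurable]: "g \<in> borel_measurable N" "r \<in> borel_measurable N"
    unfolding g_def r_def by measurable
  have gb: "\<bar>g y\<bar> \<le> K" for y
    using K by (auto simp: g_def indicator_def)
  have [measurable_cong]: "sets D = sets N" by fact
  have gD: "integrable D g"
    by (rule D.integrable_const_bound[where B=K]) (use gb in auto)
  have g2D: "integrable D (\<lambda>y. (g y)\<^sup>2)"
    by (rule D.integrable_const_bound[where B="K\<^sup>2"]) (use gb in \<open>auto intro: power2_le_iff_abs_le[THEN iffD2, OF K]\<close>)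
  have rD: "integrable D r"
  proof -
    have "r = (\<lambda>y. h y - g y)" using h_split by auto
    then show ?thesis using h gD by simp
  qed
  define a where "a = (\<integral>y. g y \<partial>D)"
  define Y where "Y = (\<lambda>i \<omega>. g (X i \<omega>) - a)"
  define R where "R = (\<lambda>i \<omega>. r (X i \<omega>) - (\<integral>y. r y \<partial>D))"
  have varD: "(\<integral>y. (g y - a)\<^sup>2 \<partial>D) \<le> K\<^sup>2" and varDi: "integrable D (\<lambda>y. (g y - a)\<^sup>2)"
  proof -
    have eq: "(\<lambda>y. (g y - a)\<^sup>2) = (\<lambda>y. (g y)\<^sup>2 - 2 * a * g y + a\<^sup>2)"
      by (auto simp: power2_diff algebra_simps)
    show "integrable D (\<lambda>y. (g y - a)\<^sup>2)" unfolding eq using gD g2D by simp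
    have "(\<integral>y. (g y - a)\<^sup>2 \<partial>D) \<le> (\<integral>y. (g y)\<^sup>2 \<partial>D)"
      using D.variance_eq[OF gD g2D] by (simp add: a_def)
    also have "\<dots> \<le> (\<integral>y. K\<^sup>2 \<partial>D)"
      by (intro integral_mono g2D) (use gb in \<open>auto intro: power2_le_iff_abs_le[THEN iffD2, OF K]\<close>)
    also have "\<dots> = K\<^sup>2" by (simp add: D.prob_space)
    finally show "(\<integral>y. (g y - a)\<^sup>2 \<partial>D) \<le> K\<^sup>2" .
  qed
  have Y_ind: "indep_vars (\<lambda>_. borel) Y I"
    unfolding Y_def by (rule indep_vars_compose2[OF ind]) auto
  have Y2: "integrable M (\<lambda>\<omega>. (Y i \<omega>)\<^sup>2)" "expectation (\<lambda>\<omega>. (Y i \<omega>)\<^sup>2) \<le> K\<^sup>2"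
    "expectation (Y i) = 0" if "i \<in> I" for i
  proof -
    show "integrable M (\<lambda>\<omega>. (Y i \<omega>)\<^sup>2)" unfolding Y_def by (rule pull_int[OF that varDi])
    show "expectation (\<lambda>\<omega>. (Y i \<omega>)\<^sup>2) \<le> K\<^sup>2" unfolding Y_def using pull_eq[OF that varDi] varD by simp
    show "expectation (Y i) = 0" unfolding Y_def
      using pull_eq[OF that gD] pull_int[OF that gD] by (simp add: prob_space a_def)
  qed
  note sq = square_sum_indep_centered[OF I Y_ind Y2(1) Y2(3)]
  have Ymeas: "(\<lambda>\<omega>. \<Sum>i\<in>I. Y i \<omega>) \<in> borel_measurable M"
    unfolding Y_def by (intro borel_measurable_sum) measurable
  have Yint: "integrable M (\<lambda>\<omega>. \<Sum>i\<in>I. Y i \<omega>)"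
    by (rule square_integrable_imp_integrable[OF Ymeas sq(1)])
  have "expectation (\<lambda>\<omega>. \<bar>\<Sum>i\<in>I. Y i \<omega>\<bar>) \<le> sqrt (\<Sum>i\<in>I. expectation (\<lambda>\<omega>. (Y i \<omega>)\<^sup>2))"
    using expectation_abs_le_sqrt[OF Ymeas sq(1)] sq(2) by simp
  also have "\<dots> \<le> sqrt (\<Sum>i\<in>I. K\<^sup>2)"
    by (intro real_sqrt_le_mono sum_mono Y2(2))
  also have "\<dots> = K * sqrt (card I)"
    using K by (simp add: real_sqrt_mult)
  finally have Ybd: "expectation (\<lambda>\<omega>. \<bar>\<Sum>i\<in>I. Y i \<omega>\<bar>) \<le> K * sqrt (card I)" .
  have Rint: "integrable M (R i)" if "i \<in> I" for i
    unfolding R_def using pull_int[OF that rD] by simp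
  define c where "c = (\<integral>y. \<bar>r y\<bar> \<partial>D)"
  have Rbd: "expectation (\<lambda>\<omega>. \<bar>R i \<omega>\<bar>) \<le> 2 * c" if "i \<in> I" for i
  proof -
    have i: "integrable M (\<lambda>\<omega>. \<bar>r (X i \<omega>)\<bar>)" using pull_int[OF that rD] by auto
    have "expectation (\<lambda>\<omega>. \<bar>R i \<omega>\<bar>) \<le> expectation (\<lambda>\<omega>. \<bar>r (X i \<omega>)\<bar> + c)"
    proof (rule integral_mono)
      show "\<bar>R i \<omega>\<bar> \<le> \<bar>r (X i \<omega>)\<bar> + c" for \<omega>
        using integral_abs_bound[of D r] unfolding R_def c_def by linarith
    qed (use i Rint[OF that] in auto)
    also have "\<dots> = expectation (\<lambda>\<omega>. \<bar>r (X i \<omega>)\<bar>) + c"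
      using i by (simp add: prob_space)
    also have "expectation (\<lambda>\<omega>. \<bar>r (X i \<omega>)\<bar>) = c"
      unfolding c_def using pull_eq[OF that, of "\<lambda>y. \<bar>r y\<bar>"] rD by simp
    finally show ?thesis by simp
  qed
  have Z: "?Z \<omega> = (\<Sum>i\<in>I. Y i \<omega>) + (\<Sum>i\<in>I. R i \<omega>)" for \<omega>
  proof -
    have "(\<integral>y. h y \<partial>D) = a + (\<integral>y. r y \<partial>D)"
      using gD rD by (simp add: h_split a_def)
    then show ?thesis
      by (simp add: Y_def R_def h_split sum.distrib sum_subtractf algebra_simps)
  qed
  have Rsint: "integrable M (\<lambda>\<omega>. \<Sum>i\<in>I. \<bar>R i \<omega>\<bar>)" "integrable M (\<lambda>\<omega>. \<Sum>i\<in>I. R i \<omega>)"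
    using Rint by auto
  show Zint: "integrable M ?Z"
    unfolding Z using Yint Rsint by simp
  have "expectation (\<lambda>\<omega>. \<bar>?Z \<omega>\<bar>) \<le> expectation (\<lambda>\<omega>. \<bar>\<Sum>i\<in>I. Y i \<omega>\<bar> + (\<Sum>i\<in>I. \<bar>R i \<omega>\<bar>))"
  proof (rule integral_mono)
    show "\<bar>?Z \<omega>\<bar> \<le> \<bar>\<Sum>i\<in>I. Y i \<omega>\<bar> + (\<Sum>i\<in>I. \<bar>R i \<omega>\<bar>)" for \<omega>
      unfolding Z using sum_abs[of "\<lambda>i. R i \<omega>" I] by linarith
  qed (use Zint Yint Rsint in auto)
  also have "\<dots> = expectation (\<lambda>\<omega>. \<bar>\<Sum>i\<in>I. Y i \<omega>\<bar>) + (\<Sum>i\<in>I. expectation (\<lambda>\<omega>. \<bar>R i \<omega>\<bar>))"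
    using Yint Rint by (subst Bochner_Integration.integral_add) auto
  also have "\<dots> \<le> K * sqrt (card I) + (\<Sum>i\<in>I. 2 * c)"
    by (intro add_mono Ybd sum_mono Rbd)
  also have "c = (\<integral>y. \<bar>h y\<bar> * indicator {y. K < \<bar>h y\<bar>} y \<partial>D)"
    unfolding c_def r_def by (simp add: abs_mult)
  finally show "expectation (\<lambda>\<omega>. \<bar>?Z \<omega>\<bar>)
      \<le> K * sqrt (card I) + 2 * card I * (\<integral>y. \<bar>h y\<bar> * indicator {y. K < \<bar>h y\<bar>} y \<partial>D)"
    by (simp add: algebra_simps)
qed

lemma (in prob_space) tail_integral_tendsto_0:
  fixes h :: "'a \<Rightarrow> real"
  assumes h: "integrable M h"
  shows "(\<lambda>k. \<integral>y. \<bar>h y\<bar> * indicator {y. real k < \<bar>h y\<bar>} y \<partial>M) \<longlonglongrightarrow> 0"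
proof -
  have "(\<lambda>k. \<integral>y. \<bar>h y\<bar> * indicator {y. real k < \<bar>h y\<bar>} y \<partial>M) \<longlonglongrightarrow> (\<integral>y. 0 \<partial>M)"
  proof (rule integral_dominated_convergence[where w="\<lambda>y. \<bar>h y\<bar>"])
    show "AE y in M. (\<lambda>k. \<bar>h y\<bar> * indicator {y. real k < \<bar>h y\<bar>} y) \<longlonglongrightarrow> 0"
    proof (rule AE_I2)
      fix y
      obtain k0 :: nat where "\<bar>h y\<bar> \<le> k0" using real_arch_simple by blast
      then have "\<forall>\<^sub>F k in sequentially. \<bar>h y\<bar> * indicator {y. real k < \<bar>h y\<bar>} y = 0"
        by (intro eventually_sequentiallyI[of k0]) (auto simp: indicator_def)
      then show "(\<lambda>k. \<bar>h y\<bar> * indicator {y. real k < \<bar>h y\<bar>} y) \<longlonglongrightarrow> 0"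
        by (rule tendsto_eventually)
    qed
  qed (use h in \<open>auto simp: indicator_def\<close>)
  then show ?thesis by simp
qed

text \<open>
  The threshold for \<open>n\<close> depends only on the common law \<open>D\<close>, not on the probability space. This
  uniformity is essential later, where the underlying measure changes with \<open>n\<close>.
\<close>

lemma eventually_weak_law:
  fixes h :: "'b \<Rightarrow> real" and \<delta> \<eta> :: real
  assumes D: "prob_space D" and h: "integrable D h" and "0 < \<delta>" "0 < \<eta>"
  shows "\<forall>\<^sub>F n in sequentially. \<forall>(M :: 'w measure) N X.
    prob_space M \<longrightarrow> sets D = sets N \<longrightarrow> prob_space.indep_vars M (\<lambda>_. N) X {1..n} \<longrightarrow>
    (\<forall>i\<in>{1..n}. distr M N (X i) = D) \<longrightarrow>
    measure M {\<omega>\<in>space M. n * \<delta> \<le> \<bar>(\<Sum>i=1..n. h (X i \<omega>)) - n * (\<integral>y. h y \<partial>D)\<bar>} \<le> \<eta>"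
proof -
  interpret D: prob_space D by fact
  define c where "c = (\<lambda>k::nat. \<integral>y. \<bar>h y\<bar> * indicator {y. real k < \<bar>h y\<bar>} y \<partial>D)"
  \<comment> \<open>The truncation level makes the remainder, entering as \<open>2 c / \<delta>\<close>, contribute half of \<open>\<eta>\<close>;
    the other half is left for the bounded part.\<close>
  have "\<forall>\<^sub>F k in sequentially. c k < \<delta> * \<eta> / 4"
    using D.tail_integral_tendsto_0[OF h] assms(3,4)
    unfolding c_def by (intro order_tendstoD) auto
  then obtain k where k: "c k < \<delta> * \<eta> / 4"
    by (meson eventually_sequentially order_refl)
  have "(\<lambda>n::nat. k / sqrt n) \<longlonglongrightarrow> 0"
    by real_asymp
  then have "\<forall>\<^sub>F n :: nat in sequentially. k / sqrt n < \<delta> * \<eta> / 2"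
    using assms(3,4) by (intro order_tendstoD) auto
  with eventually_gt_at_top[of 0] show ?thesis
  proof eventually_elim
    case (elim n)
    show ?case
    proof (intro allI impI)
      fix M :: "'w measure" and N and X :: "nat \<Rightarrow> 'w \<Rightarrow> 'b"
      assume M: "prob_space M" and s: "sets D = sets N"
        and X: "prob_space.indep_vars M (\<lambda>_. N) X {1..n}" "\<forall>i\<in>{1..n}. distr M N (X i) = D"
      interpret prob_space M by fact
      let ?Z = "\<lambda>\<omega>. (\<Sum>i=1..n. h (X i \<omega>)) - n * (\<integral>y. h y \<partial>D)"
      have Zi: "integrable M ?Z"
        using iid_mean_abs_deviation_le(1)[OF _ X(1) _ D s h, of 0] X(2) by simp
      have "expectation (\<lambda>\<omega>. \<bar>?Z \<omega>\<bar>) \<le> k * sqrt n + 2 * n * c k"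
        using iid_mean_abs_deviation_le(2)[OF _ X(1) _ D s h, of k] X(2) by (simp add: c_def)
      also have "k * sqrt n = n * (k / sqrt n)"
      proof -
        have "k * sqrt n = k * (n / sqrt n)" by (simp only: real_div_sqrt of_nat_0_le_iff)
        then show ?thesis by simp
      qed
      also have "n * (k / sqrt n) + 2 * n * c k \<le> n * (\<delta> * \<eta> / 2) + 2 * n * (\<delta> * \<eta> / 4)"
        using elim k by (intro add_mono mult_left_mono) auto
      finally have E: "expectation (\<lambda>\<omega>. \<bar>?Z \<omega>\<bar>) \<le> n * \<delta> * \<eta>" by (simp add: algebra_simps)
      have "measure M {\<omega>\<in>space M. n * \<delta> \<le> \<bar>?Z \<omega>\<bar>} \<le> expectation (\<lambda>\<omega>. \<bar>?Z \<omega>\<bar>) / (n * \<delta>)"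
        by (rule integral_Markov_inequality_measure[where A="{}"]) (use Zi elim assms in auto)
      also have "\<dots> \<le> \<eta>" using E elim assms by (subst pos_divide_le_eq) (auto simp: mult_ac)
      finally show "measure M {\<omega>\<in>space M. n * \<delta> \<le> \<bar>?Z \<omega>\<bar>} \<le> \<eta>" .
    qed
  qed
qed

section \<open>Tilting an independent sample\<close>

text \<open>
  The density is a product of functions of the single observations, so integrals of product
  functions still factorize after tilting: each factor \<open>g(X\<^sub>i)\<close> is merely replaced by
  \<open>f(X\<^sub>i) g(X\<^sub>i)\<close>. For indicators this yields independence and the marginal laws in one
  formula, and for no indicator at all the total mass 1.
\<close>

lemma (in prob_space) tilted_iid:
  fixes f :: "'b \<Rightarrow> ennreal"
  assumes I: "finite I" and ind: "indep_vars (\<lambda>_. N) X I"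
    and law: "\<And>i. i \<in> I \<Longrightarrow> distr M N (X i) = \<mu>" and s: "sets \<mu> = sets N"
    and f[measurable]: "f \<in> borel_measurable N" and f1: "(\<integral>\<^sup>+y. f y \<partial>\<mu>) = 1"
  defines "Q \<equiv> density M (\<lambda>\<omega>. \<Prod>i\<in>I. f (X i \<omega>))"
  shows "prob_space Q" "prob_space.indep_vars Q (\<lambda>_. N) X I"
    and "\<And>i. i \<in> I \<Longrightarrow> distr Q N (X i) = density \<mu> f"
proof -
  have [measurable]: "X i \<in> measurable M N" if "i \<in> I" for i
    using ind that by (auto simp: indep_vars_def)
  have sQ[measurable_cong, simp]: "sets Q = sets M" and spQ[simp]: "space Q = space M"
    by (simp_all add: Q_def)
  have [measurable_cong]: "sets \<mu> = sets N" by fact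
  have dens[measurable]: "(\<lambda>\<omega>. \<Prod>i\<in>I. f (X i \<omega>)) \<in> borel_measurable M"
    by (intro borel_measurable_prod_ennreal) measurable
  have joint: "emeasure Q {\<omega>\<in>space M. \<forall>j\<in>J. X j \<omega> \<in> A j} = (\<Prod>j\<in>J. emeasure (density \<mu> f) (A j))"
    if J: "J \<subseteq> I" and A: "\<And>j. j \<in> J \<Longrightarrow> A j \<in> sets N" for J A
  proof -
    define u where "u = (\<lambda>i y. f y * (if i \<in> J then indicator (A i) y else 1) :: ennreal)"
    have finJ: "finite J" using I J finite_subset by auto
    have u[measurable]: "u i \<in> borel_measurable N" for i
      using A[of i] by (cases "i \<in> J") (auto simp: u_def)
    have [measurable]: "{\<omega>\<in>space M. \<forall>j\<in>J. X j \<omega> \<in> A j} \<in> sets M"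
    proof -
      have [measurable]: "X j \<in> measurable M N" "A j \<in> sets N" if "j \<in> J" for j
        using J A that by auto
      show ?thesis using finJ by measurable
    qed
    have "emeasure Q {\<omega>\<in>space M. \<forall>j\<in>J. X j \<omega> \<in> A j}
        = (\<integral>\<^sup>+\<omega>. (\<Prod>i\<in>I. f (X i \<omega>)) * indicator {\<omega>\<in>space M. \<forall>j\<in>J. X j \<omega> \<in> A j} \<omega> \<partial>M)"
      unfolding Q_def by (rule emeasure_density) measurable
    also have "\<dots> = (\<integral>\<^sup>+\<omega>. (\<Prod>i\<in>I. u i (X i \<omega>)) \<partial>M)"
    proof (rule nn_integral_cong)
      fix \<omega> assume "\<omega> \<in> space M"
      have "(\<Prod>i\<in>I. if i \<in> J then indicator (A i) (X i \<omega>) else 1) = (\<Prod>i\<in>J. indicator (A i) (X i \<omega>) :: ennreal)"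
        using I J by (simp add: prod.If_cases Int_absorb1)
      also have "\<dots> = indicator {\<omega>\<in>space M. \<forall>j\<in>J. X j \<omega> \<in> A j} \<omega>"
        using finJ \<open>\<omega> \<in> space M\<close> by (auto simp: indicator_def)
      finally show "(\<Prod>i\<in>I. f (X i \<omega>)) * indicator {\<omega>\<in>space M. \<forall>j\<in>J. X j \<omega> \<in> A j} \<omega> = (\<Prod>i\<in>I. u i (X i \<omega>))"
        by (simp add: u_def prod.distrib)
    qed
    also have "\<dots> = (\<Prod>i\<in>I. \<integral>\<^sup>+\<omega>. u i (X i \<omega>) \<partial>M)"
      by (rule indep_vars_nn_integral[OF I]) (auto intro!: indep_vars_compose2[OF ind])
    also have "\<dots> = (\<Prod>i\<in>I. \<integral>\<^sup>+y. u i y \<partial>\<mu>)"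
    proof (rule prod.cong)
      fix i assume i: "i \<in> I"
      then show "(\<integral>\<^sup>+\<omega>. u i (X i \<omega>) \<partial>M) = (\<integral>\<^sup>+y. u i y \<partial>\<mu>)"
        by (subst law[OF i, symmetric], subst nn_integral_distr) auto
    qed simp
    also have "\<dots> = (\<Prod>i\<in>I. if i \<in> J then emeasure (density \<mu> f) (A i) else 1)"
    proof (rule prod.cong)
      fix i
      show "(\<integral>\<^sup>+y. u i y \<partial>\<mu>) = (if i \<in> J then emeasure (density \<mu> f) (A i) else 1)"
        using A[of i] f1 by (auto simp: u_def emeasure_density s)
    qed simp
    also have "\<dots> = (\<Prod>j\<in>J. emeasure (density \<mu> f) (A j))"
      using I J by (simp add: prod.If_cases Int_absorb1)
    finally show ?thesis .
  qed
  show Q: "prob_space Q"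
    using joint[of "{}"] by (intro prob_spaceI) auto
  interpret Q: prob_space Q by fact
  have single: "emeasure Q (X i -` A \<inter> space M) = emeasure (density \<mu> f) A" if "i \<in> I" "A \<in> sets N" for i A
  proof -
    have "X i -` A \<inter> space M = {\<omega>\<in>space M. \<forall>j\<in>{i}. X j \<omega> \<in> A}" by auto
    then show ?thesis using joint[of "{i}" "\<lambda>_. A"] that by simp
  qed
  show "distr Q N (X i) = density \<mu> f" if "i \<in> I" for i
  proof (rule measure_eqI)
    show "emeasure (distr Q N (X i)) A = emeasure (density \<mu> f) A" if "A \<in> sets (distr Q N (X i))" for A
      using that \<open>i \<in> I\<close> single[of i A] by (subst emeasure_distr) auto
  qed (simp add: s)
  show "Q.indep_vars (\<lambda>_. N) X I"
    unfolding Q.indep_vars_def2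
  proof (intro conjI ballI Q.indep_setsI)
    fix B J assume J: "J \<noteq> {}" "J \<subseteq> I" "finite J"
      and "\<forall>j\<in>J. B j \<in> {X j -` A \<inter> space Q |A. A \<in> sets N}"
    then have "\<forall>j\<in>J. \<exists>A. A \<in> sets N \<and> B j = X j -` A \<inter> space M" by auto
    then obtain A where A: "\<And>j. j \<in> J \<Longrightarrow> A j \<in> sets N" "\<And>j. j \<in> J \<Longrightarrow> B j = X j -` A j \<inter> space M"
      by metis
    have "(\<Inter>j\<in>J. B j) = {\<omega>\<in>space M. \<forall>j\<in>J. X j \<omega> \<in> A j}"
      using J(1) A(2) by auto
    then have "emeasure Q (\<Inter>j\<in>J. B j) = (\<Prod>j\<in>J. emeasure Q (B j))"
      using joint[OF J(2), of A] A single J(2) by (simp add: subset_iff)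
    then have "ennreal (Q.prob (\<Inter>j\<in>J. B j)) = ennreal (\<Prod>j\<in>J. Q.prob (B j))"
      by (simp add: Q.emeasure_eq_measure prod_ennreal)
    then show "Q.prob (\<Inter>j\<in>J. B j) = (\<Prod>j\<in>J. Q.prob (B j))"
      by (simp add: prod_nonneg)
  next
    fix i assume "i \<in> I"
    then show "X i \<in> measurable Q N" by measurable
  qed (auto intro: measurable_sets)
qed


text \<open>
  The events \<open>A n\<close> are likely under the tilted laws because they contain the event that the sample
  mean of \<open>h\<close> is at least \<open>c\<close>, which lies below the mean of \<open>h\<close> under the tilted law. The price
  for the tilt is the density, whose logarithm concentrates around \<open>n\<close> times the entropy.
\<close>

lemma eventually_prob_ge_of_tilting:
  fixes P :: "'w measure" and f h :: "'b \<Rightarrow> real" and c \<epsilon> :: real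
  assumes P: "prob_space P" and ind: "prob_space.indep_vars P (\<lambda>_. N) X {1::nat..}"
    and law: "\<And>i. 1 \<le> i \<Longrightarrow> distr P N (X i) = \<mu>" and s: "sets \<mu> = sets N"
    and f[measurable]: "f \<in> borel_measurable N" and f0: "\<And>y. 0 \<le> f y"
    and \<nu>: "prob_space (density \<mu> f)"
    and lnf: "integrable (density \<mu> f) (\<lambda>y. ln (f y))"
    and h: "integrable (density \<mu> f) h"
    and c: "c < (\<integral>y. h y \<partial>density \<mu> f)" and \<epsilon>: "0 < \<epsilon>"
    and A: "\<And>n. 0 < n \<Longrightarrow> A n \<in> sets P"
    and hA: "\<And>n \<omega>. 0 < n \<Longrightarrow> \<omega> \<in> space P \<Longrightarrow> n * c \<le> (\<Sum>i=1..n. h (X i \<omega>)) \<Longrightarrow> \<omega> \<in> A n"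
  shows "\<forall>\<^sub>F n in sequentially.
    exp (- (n * ((\<integral>y. ln (f y) \<partial>density \<mu> f) + \<epsilon>))) / 2 \<le> measure P (A n)"
proof -
  interpret P: prob_space P by fact
  define H where "H = (\<integral>y. ln (f y) \<partial>density \<mu> f)"
  define \<delta> where "\<delta> = (\<integral>y. h y \<partial>density \<mu> f) - c"
  have \<delta>: "0 < \<delta>" using c by (simp add: \<delta>_def)
  have [measurable]: "X i \<in> measurable P N" if "1 \<le> i" for i
    using ind that by (auto simp: P.indep_vars_def)
  have [measurable_cong]: "sets \<mu> = sets N" by fact
  have [measurable]: "h \<in> borel_measurable N"
    using borel_measurable_integrable[OF h] s by (metis measurable_cong_sets sets_density)
  have q: "0 < (1/4 :: real)" by simp
  show ?thesis
    using eventually_gt_at_top[of 0] eventually_weak_law[OF \<nu> h \<delta> q, where ?'w='w]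
      eventually_weak_law[OF \<nu> lnf \<epsilon> q, where ?'w='w]
  proof eventually_elim
    case (elim n)
    define Q where "Q = density P (\<lambda>\<omega>. \<Prod>i\<in>{1..n}. ennreal (f (X i \<omega>)))"
    have ind': "P.indep_vars (\<lambda>_. N) X {1..n}"
      using ind by (rule P.indep_vars_subset) auto
    have f1: "(\<integral>\<^sup>+y. ennreal (f y) \<partial>\<mu>) = 1"
      using prob_space.emeasure_space_1[OF \<nu>] by (simp add: emeasure_density cong: nn_integral_cong)
    have iid: "prob_space Q" "prob_space.indep_vars Q (\<lambda>_. N) X {1..n}"
      "\<forall>i\<in>{1..n}. distr Q N (X i) = density \<mu> f"
      using P.tilted_iid[OF _ ind' law s _ f1] by (auto simp: Q_def)
    interpret Q: prob_space Q by fact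
    have [measurable_cong]: "sets Q = sets P" and spQ[simp]: "space Q = space P"
      by (simp_all add: Q_def)
    have Xn[measurable]: "X i \<in> measurable P N" if "i \<in> {1..n}" for i
      using that by auto
    define B1 where "B1 = {\<omega>\<in>space Q. n * \<delta> \<le> \<bar>(\<Sum>i=1..n. h (X i \<omega>)) - n * (\<integral>y. h y \<partial>density \<mu> f)\<bar>}"
    define B2 where "B2 = {\<omega>\<in>space Q. n * \<epsilon> \<le> \<bar>(\<Sum>i=1..n. ln (f (X i \<omega>))) - n * H\<bar>}"
    define G where "G = space Q - (B1 \<union> B2)"
    have [measurable]: "B1 \<in> sets Q" "B2 \<in> sets Q"
      unfolding B1_def B2_def by measurable
    have "measure Q B1 \<le> 1/4" "measure Q B2 \<le> 1/4"
      using elim(2,3) iid s unfolding B1_def B2_def H_def by auto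
    then have "measure Q (B1 \<union> B2) \<le> 1/2"
      using measure_Un_le[of B1 Q B2] by simp
    then have QG: "1/2 \<le> measure Q G"
      unfolding G_def by (subst Q.prob_compl) auto
    have "G \<in> sets Q" unfolding G_def by auto
    then have [measurable]: "G \<in> sets P" by (simp add: Q_def)
    \<comment> \<open>Since \<open>ln 0 = 0\<close>, the bound on the sum of the \<open>ln (f (X i \<omega>))\<close> says nothing about samples
      at which the density vanishes; there the product is \<open>0\<close>.\<close>
    have dens_le: "(\<Prod>i\<in>{1..n}. f (X i \<omega>)) \<le> exp (n * (H + \<epsilon>))" if "\<omega> \<in> G" for \<omega>
    proof (cases "\<forall>i\<in>{1..n}. f (X i \<omega>) \<noteq> 0")
      case True
      then have pos: "\<And>i. i \<in> {1..n} \<Longrightarrow> 0 < f (X i \<omega>)"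
        using f0 by (simp add: less_le)
      then have "(\<Prod>i\<in>{1..n}. f (X i \<omega>)) = exp (\<Sum>i=1..n. ln (f (X i \<omega>)))"
        by (simp add: exp_sum)
      also have "\<dots> \<le> exp (n * (H + \<epsilon>))"
        using that by (auto simp: G_def B2_def algebra_simps)
      finally show ?thesis .
    next
      case False
      then have zero: "(\<Prod>i\<in>{1..n}. f (X i \<omega>)) = 0" by (intro prod_zero) auto
      show ?thesis unfolding zero by simp
    qed
    have "emeasure Q G = (\<integral>\<^sup>+\<omega>. (\<Prod>i\<in>{1..n}. ennreal (f (X i \<omega>))) * indicator G \<omega> \<partial>P)"
      unfolding Q_def by (rule emeasure_density) measurable
    also have "\<dots> \<le> (\<integral>\<^sup>+\<omega>. ennreal (exp (n * (H + \<epsilon>))) * indicator G \<omega> \<partial>P)"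
      using dens_le f0 by (intro nn_integral_mono) (auto simp: prod_ennreal indicator_def)
    also have "\<dots> = ennreal (exp (n * (H + \<epsilon>)) * measure P G)"
      by (simp add: nn_integral_cmult_indicator P.emeasure_eq_measure ennreal_mult)
    finally have "measure Q G \<le> exp (n * (H + \<epsilon>)) * measure P G"
      by (simp add: Q.emeasure_eq_measure)
    also have "measure P G \<le> measure P (A n)"
    proof (rule P.finite_measure_mono)
      show "G \<subseteq> A n"
      proof
        fix \<omega> assume "\<omega> \<in> G"
        then show "\<omega> \<in> A n"
          using hA[OF elim(1), of \<omega>] by (auto simp: G_def B1_def \<delta>_def algebra_simps)
      qed
    qed (use A elim in auto)
    finally have "1/2 \<le> exp (n * (H + \<epsilon>)) * measure P (A n)"
      using QG by (simp add: mult_left_mono)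
    then show ?case
      unfolding H_def[symmetric] exp_minus by (simp add: field_simps)
  qed
qed

section \<open>The transport cost of empirical measures\<close>

text \<open>
  An empirical measure is the law of a uniformly chosen sample point, which reduces its integrals to
  those against the uniform distribution on the indices.
\<close>

lemma empirical_measure_eq_distr:
  assumes "0 < n"
  shows "empirical_measure n x = distr (measure_pmf (pmf_of_set {1..n})) borel x"
proof (rule measure_eqI)
  fix A assume "A \<in> sets (empirical_measure n x)"
  then have A: "A \<in> sets borel" by (simp add: sets_empirical_measure)
  have "(\<Sum>i=1..n. emeasure (return borel (x i)) A) = (\<Sum>i=1..n. of_bool (i \<in> x -` A))"
    using A by (intro sum.cong) (auto simp: indicator_def)
  also have "\<dots> = card ({1..n} \<inter> x -` A)"
    by (simp add: Int_def)
  finally have "emeasure (empirical_measure n x) A = ennreal (1 / n) * card ({1..n} \<inter> x -` A)"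
    using A by (simp add: emeasure_empirical_measure)
  also have "\<dots> = emeasure (distr (measure_pmf (pmf_of_set {1..n})) borel x) A"
    using A assms
    by (simp add: emeasure_distr emeasure_pmf_of_set ennreal_of_nat_eq_real_of_nat
        flip: ennreal_mult')
  finally show "emeasure (empirical_measure n x) A = \<dots>" .
qed (simp add: sets_empirical_measure)

lemma integral_empirical_measure:
  assumes "0 < n" "\<phi> \<in> borel_measurable borel"
  shows "(\<integral>y. \<phi> y \<partial>empirical_measure n x) = (\<Sum>i=1..n. \<phi> (x i)) / real n"
  unfolding empirical_measure_eq_distr[OF assms(1)]
  using assms by (simp add: integral_distr integral_pmf_of_set)

lemma transport_cost_ge:
  assumes "(\<psi>, \<phi>) \<in> \<Phi>"
  shows "ereal ((\<integral>x. \<psi> x \<partial>\<mu>) + (\<integral>x. \<phi> x \<partial>\<nu>)) \<le> transport_cost \<mu> \<Phi> \<nu>"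
  unfolding transport_cost_def using assms by (intro SUP_upper2[where i="(\<psi>, \<phi>)"]) auto

lemma less_transport_cost_iff:
  "a < transport_cost \<mu> \<Phi> \<nu> \<longleftrightarrow>
    (\<exists>\<psi> \<phi>. (\<psi>, \<phi>) \<in> \<Phi> \<and> a < ereal ((\<integral>x. \<psi> x \<partial>\<mu>) + (\<integral>x. \<phi> x \<partial>\<nu>)))"
  unfolding transport_cost_def less_SUP_iff by force

text \<open>
  As a function of the sample, the transport cost is a supremum of continuous functions, hence lower
  semicontinuous, hence Borel on the product space \<open>nat \<Rightarrow> 'a\<close>. Second countability enters because
  it makes the Borel \<open>\<sigma>\<close>-algebra of the product equal to the product \<open>\<sigma>\<close>-algebra, so that the sample
  is a measurable map into it.
\<close>

lemma sets_transport_cost_empirical_ge: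
  fixes X :: "nat \<Rightarrow> 'w \<Rightarrow> 'a::second_countable_topology"
  assumes n: "0 < n" and X: "\<And>i. 1 \<le> i \<Longrightarrow> X i \<in> borel_measurable P"
    and \<Phi>: "\<And>\<psi> \<phi>. (\<psi>, \<phi>) \<in> \<Phi> \<Longrightarrow> continuous_on UNIV \<phi>"
  shows "{\<omega> \<in> space P. ereal t \<le> transport_cost \<mu> \<Phi> (empirical_measure n (\<lambda>i. X i \<omega>))} \<in> sets P"
proof -
  define C where "C = (\<lambda>x. transport_cost \<mu> \<Phi> (empirical_measure n x))"
  have "open {x. a < C x}" for a
  proof -
    have "{x. a < C x} = (\<Union>(\<psi>, \<phi>)\<in>\<Phi>. {x. a < ereal ((\<integral>y. \<psi> y \<partial>\<mu>) + (\<Sum>i=1..n. \<phi> (x i)) / n)})"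
      using \<Phi> by (force simp: C_def less_transport_cost_iff n integral_empirical_measure
          borel_measurable_continuous_onI)
    moreover have "open {x. a < ereal ((\<integral>y. \<psi> y \<partial>\<mu>) + (\<Sum>i=1..n. \<phi> (x i)) / n)}"
      if "(\<psi>, \<phi>) \<in> \<Phi>" for \<psi> \<phi>
    proof (rule open_Collect_less)
      have "continuous_on UNIV (\<lambda>x :: nat \<Rightarrow> 'a. \<phi> (x i))" for i
        by (rule continuous_on_compose2[OF \<Phi>[OF that] continuous_on_product_coordinates]) simp
      then show "continuous_on UNIV (\<lambda>x :: nat \<Rightarrow> 'a. ereal ((\<integral>y. \<psi> y \<partial>\<mu>) + (\<Sum>i=1..n. \<phi> (x i)) / n))"
        using n by (intro continuous_intros) auto
    qed auto
    ultimately show ?thesis by (auto intro!: open_UN)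
  qed
  then have [measurable]: "C \<in> borel_measurable borel"
    by (intro borel_measurableI_greater) auto
  \<comment> \<open>Samples start at index 1; \<open>X 0\<close> is unspecified and may be non-measurable, so it is replaced.\<close>
  have C_eq: "C (\<lambda>i. X i \<omega>) = C (\<lambda>i. X (max 1 i) \<omega>)" for \<omega>
  proof -
    have "empirical_measure n (\<lambda>i. X i \<omega>) = empirical_measure n (\<lambda>i. X (max 1 i) \<omega>)"
      unfolding empirical_measure_def
      by (intro arg_cong[where f="measure_of _ _"] ext arg_cong2[where f="(*)"] sum.cong)
        (auto simp: max_def)
    then show ?thesis by (simp add: C_def)
  qed
  have [measurable]: "(\<lambda>\<omega> i. X (max 1 i) \<omega>) \<in> borel_measurable P"
    by (intro measurable_coordinatewise_then_product X) simp
  have "{\<omega> \<in> space P. ereal t \<le> C (\<lambda>i. X (max 1 i) \<omega>)} \<in> sets P"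
    by measurable
  then show ?thesis
    unfolding C_eq[symmetric] unfolding C_def .
qed

section \<open>From deviation to transport\<close>

lemma exponential_lower_bound_le_limsup:
  fixes p :: "nat \<Rightarrow> real" and c :: real
  assumes "\<forall>\<^sub>F n in sequentially. exp (- (n * c)) / 2 \<le> p n"
  shows "ereal (- c) \<le> limsup (\<lambda>n. ereal (1 / real n) * ext_ln (p n))"
proof -
  have lim: "(\<lambda>n :: nat. ereal (- c - ln 2 / n)) \<longlonglongrightarrow> ereal (- c)"
    unfolding lim_ereal by real_asymp
  have "ereal (- c) = limsup (\<lambda>n :: nat. ereal (- c - ln 2 / n))"
    using lim_imp_Limsup[OF _ lim] by simp
  also have "\<dots> \<le> limsup (\<lambda>n. ereal (1 / real n) * ext_ln (p n))"
  proof (rule Limsup_mono)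
    show "\<forall>\<^sub>F n in sequentially. ereal (- c - ln 2 / n) \<le> ereal (1 / real n) * ext_ln (p n)"
      using assms eventually_gt_at_top[of 0]
    proof eventually_elim
      case (elim n)
      have "0 < exp (- (n * c)) / 2" by simp
      then have p: "0 < p n" using elim(1) by linarith
      have "- (n * c) - ln 2 = ln (exp (- (n * c)) / 2)"
        by (simp add: ln_div)
      also have "\<dots> \<le> ln (p n)"
        using elim(1) p by (subst ln_le_cancel_iff) auto
      finally have "(1 / n) * (- (n * c) - ln 2) \<le> (1 / n) * ln (p n)"
        by (rule mult_left_mono) simp
      also have "(1 / n) * (- (n * c) - ln 2) = - c - ln 2 / n"
        using elim(2) by (simp add: field_simps)
      finally have "- c - ln 2 / n \<le> (1 / n) * ln (p n)" .
      then show ?case using p by (simp add: ext_ln_def)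
    qed
  qed
  finally show ?thesis .
qed

text \<open>
  The real-valued version of the Radon-Nikodym derivative is a density because the derivative is
  almost everywhere finite.
\<close>

lemma rel_entropy_finite_density:
  assumes \<mu>: "prob_space \<mu>" and \<nu>: "prob_space \<nu>" and s: "sets \<nu> = sets \<mu>"
    and fin: "rel_entropy \<nu> \<mu> \<noteq> \<infinity>"
  obtains f where "f \<in> borel_measurable \<mu>" "\<And>x. 0 \<le> f x" "\<nu> = density \<mu> (\<lambda>x. ennreal (f x))"
    "integrable \<nu> (\<lambda>x. ln (f x))" "rel_entropy \<nu> \<mu> = ereal (\<integral>x. ln (f x) \<partial>\<nu>)"
proof -
  interpret \<mu>: prob_space \<mu> by fact
  interpret \<nu>: prob_space \<nu> by fact
  define f where "f = (\<lambda>x. enn2real (RN_deriv \<mu> \<nu> x))"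
  have ac: "absolutely_continuous \<mu> \<nu>" and int: "integrable \<nu> (entropy_density (exp 1) \<mu> \<nu>)"
    and eq: "rel_entropy \<nu> \<mu> = ereal (KL_divergence (exp 1) \<mu> \<nu>)"
    using fin by (auto simp: rel_entropy_def split: if_splits)
  have ed: "entropy_density (exp 1) \<mu> \<nu> = (\<lambda>x. ln (f x))"
    by (auto simp: entropy_density_def f_def log_ln)
  have fm: "f \<in> borel_measurable \<mu>" by (simp add: f_def)
  have "AE x in \<mu>. RN_deriv \<mu> \<nu> x \<noteq> \<infinity>"
    by (rule \<mu>.RN_deriv_finite) (use ac s in \<open>auto simp: \<nu>.sigma_finite_measure_axioms\<close>)
  then have "density \<mu> (RN_deriv \<mu> \<nu>) = density \<mu> (\<lambda>x. ennreal (f x))"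
    using fm by (intro density_cong) (auto simp: f_def less_top)
  then have dens: "\<nu> = density \<mu> (\<lambda>x. ennreal (f x))"
    using \<mu>.density_RN_deriv[OF ac s] by simp
  show ?thesis
  proof (rule that[OF fm _ dens])
    show "0 \<le> f x" for x by (simp add: f_def)
    show "integrable \<nu> (\<lambda>x. ln (f x))" using int unfolding ed .
    show "rel_entropy \<nu> \<mu> = ereal (\<integral>x. ln (f x) \<partial>\<nu>)" using eq unfolding KL_divergence_def ed .
  qed
qed

lemma rel_entropy_nonneg:
  assumes \<mu>: "prob_space \<mu>" and \<nu>: "prob_space \<nu>" and s: "sets \<nu> = sets \<mu>"
  shows "0 \<le> rel_entropy \<nu> \<mu>"
proof (cases "rel_entropy \<nu> \<mu> = \<infinity>")
  case False
  then obtain f where f: "f \<in> borel_measurable \<mu>" "\<And>x. 0 \<le> f x" "\<nu> = density \<mu> (\<lambda>x. ennreal (f x))"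
    "integrable \<nu> (\<lambda>x. ln (f x))"
    using rel_entropy_finite_density[OF assms] by metis
  interpret information_space \<mu> "exp 1"
    using \<mu> by (simp add: information_space_def information_space_axioms_def)
  have "integrable \<mu> (\<lambda>x. f x * ln (f x))"
    using f integrable_real_density[of f \<mu> "\<lambda>x. ln (f x)"] by simp
  then have "0 \<le> KL_divergence (exp 1) \<mu> \<nu>"
    using f \<nu> unfolding f(3) by (intro KL_nonneg) (auto simp: log_ln)
  then show ?thesis using False by (auto simp: rel_entropy_def split: if_splits)
qed simp

text \<open>
  At a positive finite value of \<open>T\<close> this is left continuity, at \<open>\<infinity>\<close> it is monotone convergence of
  \<open>\<alpha>\<close> to its supremum. At \<open>T = 0\<close> there is no admissible \<open>t\<close>, and the bound is the
  normalization of \<open>\<alpha>\<close> at \<open>0\<close>.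
\<close>

lemma extend_top_le:
  assumes \<alpha>: "left_cont_increasing \<alpha>" "\<alpha> 0 = 0" and T: "0 \<le> T" and b: "0 \<le> b"
    and le: "\<And>t. 0 \<le> t \<Longrightarrow> ereal t < T \<Longrightarrow> \<alpha> t \<le> b"
  shows "extend_top \<alpha> T \<le> b"
proof (cases T)
  case (real r)
  show ?thesis
  proof (cases "r = 0")
    case True
    then show ?thesis using real \<alpha> b by (simp add: extend_top_def)
  next
    case False
    then have r: "0 < r" using T real by simp
    then have "(\<alpha> \<longlongrightarrow> \<alpha> r) (at_left r)"
      using \<alpha>(1) by (simp add: left_cont_increasing_def continuous_within)
    moreover have "\<forall>\<^sub>F t in at_left r. \<alpha> t \<le> b"
      using eventually_at_left_real[OF r] by eventually_elim (use le real in auto)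
    ultimately have "\<alpha> r \<le> b"
      by (rule tendsto_upperbound) simp
    then show ?thesis using real by (simp add: extend_top_def)
  qed
next
  case PInf
  define l where "l = (SUP t\<in>{0..}. \<alpha> t)"
  have "(\<alpha> \<longlongrightarrow> l) at_top"
  proof (rule increasing_tendsto)
    show "\<forall>\<^sub>F t in at_top. \<alpha> t \<le> l"
      using eventually_ge_at_top[of 0] by eventually_elim (auto simp: l_def intro: SUP_upper)
    fix x assume "x < l"
    then obtain t where t: "0 \<le> t" "x < \<alpha> t" by (auto simp: l_def less_SUP_iff)
    show "\<forall>\<^sub>F u in at_top. x < \<alpha> u"
      using eventually_ge_at_top[of t]
    proof eventually_elim
      case (elim u)
      then have "\<alpha> t \<le> \<alpha> u"
        using \<alpha>(1) t unfolding left_cont_increasing_def by (auto intro: mono_onD[where A="{0..}"])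
      then show ?case using t by simp
    qed
  qed
  then have "extend_top \<alpha> T = l"
    using PInf by (simp add: extend_top_def tendsto_Lim)
  also have "\<dots> \<le> b"
    unfolding l_def using le PInf by (intro SUP_least) auto
  finally show ?thesis .
qed (use T in auto)

theorem proposition5p5:
  fixes \<mu> :: "'a::polish_space measure"
    and \<F> :: "('a \<Rightarrow> real) set"
    and \<Phi> :: "(('a \<Rightarrow> real) \<times> ('a \<Rightarrow> real)) set"
    and P :: "'w measure"
    and X :: "nat \<Rightarrow> 'w \<Rightarrow> 'a"
    and \<alpha> :: "real \<Rightarrow> ereal"
  assumes "\<mu> \<in> borel_prob"
    and "function_subspace \<F>"
    and "\<F> \<subseteq> borel_measurable borel"
    and "\<And>\<phi>. \<phi> \<in> \<F> \<Longrightarrow> integrable \<mu> (\<lambda>x. exp (\<phi> x))"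
    and "((\<lambda>_. 0), (\<lambda>_. 0)) \<in> \<Phi>"
    and "\<Phi> \<subseteq> \<F> \<times> \<F>"
    and "\<And>\<psi> \<phi>. (\<psi>, \<phi>) \<in> \<Phi> \<Longrightarrow> continuous_on UNIV \<psi> \<and> continuous_on UNIV \<phi>"
    and "iid_sequence P X \<mu>"
    and "deviation_function P X \<mu> \<Phi> \<alpha>"
    and "\<alpha> \<in> class_C"
  shows "transportation_function \<mu> \<F> \<Phi> \<alpha>"
  unfolding transportation_function_def
proof (intro conjI ballI)
  show \<alpha>: "left_cont_increasing \<alpha>"
    using assms(10) by (simp add: class_C_def)
  fix \<nu> assume "\<nu> \<in> prob_integrating \<F>"
  then have \<nu>: "prob_space \<nu>" "sets \<nu> = sets borel" and int: "\<And>\<phi>. \<phi> \<in> \<F> \<Longrightarrow> integrable \<nu> \<phi>"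
    by (auto simp: prob_integrating_def borel_prob_def)
  have \<mu>: "prob_space \<mu>" "sets \<mu> = sets borel"
    using assms(1) by (auto simp: borel_prob_def)
  have s: "sets \<nu> = sets \<mu>" using \<mu> \<nu> by simp
  show "extend_top \<alpha> (transport_cost \<mu> \<Phi> \<nu>) \<le> rel_entropy \<nu> \<mu>"
  proof (rule extend_top_le[OF \<alpha>])
    show "\<alpha> 0 = 0" using assms(10) by (simp add: class_C_def)
    show "0 \<le> transport_cost \<mu> \<Phi> \<nu>"
      using transport_cost_ge[OF assms(5), of \<mu> \<nu>] by (simp flip: zero_ereal_def)
    show "0 \<le> rel_entropy \<nu> \<mu>" by (rule rel_entropy_nonneg[OF \<mu>(1) \<nu>(1) s])
    fix t :: real assume t: "0 \<le> t" "ereal t < transport_cost \<mu> \<Phi> \<nu>"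
    show "\<alpha> t \<le> rel_entropy \<nu> \<mu>"
    proof (cases "rel_entropy \<nu> \<mu> = \<infinity>")
      case False
      obtain f where f: "f \<in> borel_measurable \<mu>" "\<And>x. 0 \<le> f x" "\<nu> = density \<mu> (\<lambda>x. ennreal (f x))"
        "integrable \<nu> (\<lambda>x. ln (f x))" and H: "rel_entropy \<nu> \<mu> = ereal (\<integral>x. ln (f x) \<partial>\<nu>)"
        using rel_entropy_finite_density[OF \<mu>(1) \<nu>(1) s False] by metis
      have fb: "f \<in> borel_measurable borel"
        using f(1) \<mu>(2) by (metis measurable_cong_sets)
      obtain \<psi> \<phi> where \<Phi>: "(\<psi>, \<phi>) \<in> \<Phi>" "t < (\<integral>x. \<psi> x \<partial>\<mu>) + (\<integral>x. \<phi> x \<partial>\<nu>)"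
        using t(2) by (auto simp: less_transport_cost_iff)
      \<comment> \<open>An empirical mean of \<open>\<phi>\<close> of at least \<open>c\<close> forces the transport cost to be at least \<open>t\<close>.\<close>
      define c where "c = t - (\<integral>x. \<psi> x \<partial>\<mu>)"
      have \<phi>int: "integrable \<nu> \<phi>" using int \<Phi>(1) assms(6) by auto
      have \<phi>cont: "continuous_on UNIV \<phi>" using assms(7)[OF \<Phi>(1)] by simp
      have iid: "prob_space P" "prob_space.indep_vars P (\<lambda>_. borel) X {1..}"
        "\<And>i. 1 \<le> i \<Longrightarrow> distr P borel (X i) = \<mu>"
        using assms(8) by (auto simp: iid_sequence_def)
      have Xm: "X i \<in> borel_measurable P" if "1 \<le> i" for i
        using iid(2) that unfolding prob_space.indep_vars_def[OF iid(1)] by auto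
      define A where "A = (\<lambda>n. {\<omega> \<in> space P.
        ereal t \<le> transport_cost \<mu> \<Phi> (empirical_measure n (\<lambda>i. X i \<omega>))})"
      have A: "A n \<in> sets P" if "0 < n" for n
        unfolding A_def by (rule sets_transport_cost_empirical_ge[OF that Xm]) (use assms(7) in auto)
      have hA: "\<omega> \<in> A n" if "0 < n" "\<omega> \<in> space P" "n * c \<le> (\<Sum>i=1..n. \<phi> (X i \<omega>))" for n \<omega>
      proof -
        have "t \<le> (\<integral>x. \<psi> x \<partial>\<mu>) + (\<Sum>i=1..n. \<phi> (X i \<omega>)) / n"
          using that by (simp add: c_def field_simps)
        then have "ereal t \<le> ereal ((\<integral>x. \<psi> x \<partial>\<mu>) + (\<integral>x. \<phi> x \<partial>empirical_measure n (\<lambda>i. X i \<omega>)))"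
          using \<phi>cont that by (simp add: integral_empirical_measure borel_measurable_continuous_onI)
        also have "\<dots> \<le> transport_cost \<mu> \<Phi> (empirical_measure n (\<lambda>i. X i \<omega>))"
          by (rule transport_cost_ge[OF \<Phi>(1)])
        finally show ?thesis using that by (simp add: A_def)
      qed
      have "\<alpha> t \<le> ereal (\<integral>x. ln (f x) \<partial>\<nu>) + ereal \<epsilon>" if "0 < \<epsilon>" for \<epsilon>
      proof -
        have "\<forall>\<^sub>F n in sequentially. exp (- (n * ((\<integral>y. ln (f y) \<partial>\<nu>) + \<epsilon>))) / 2 \<le> measure P (A n)"
          unfolding f(3)
        proof (rule eventually_prob_ge_of_tilting[OF iid \<mu>(2) fb f(2), where h=\<phi> and c=c])
          show "prob_space (density \<mu> (\<lambda>x. ennreal (f x)))" using \<nu>(1) unfolding f(3) .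
          show "integrable (density \<mu> (\<lambda>x. ennreal (f x))) (\<lambda>x. ln (f x))" using f(4) unfolding f(3) .
          show "integrable (density \<mu> (\<lambda>x. ennreal (f x))) \<phi>" using \<phi>int unfolding f(3) .
          show "c < (\<integral>x. \<phi> x \<partial>density \<mu> (\<lambda>x. ennreal (f x)))"
            using \<Phi>(2) unfolding f(3) c_def by simp
        qed (assumption | fact that | rule A, assumption | rule hA, assumption+)+
        then have "ereal (- ((\<integral>y. ln (f y) \<partial>\<nu>) + \<epsilon>))
            \<le> limsup (\<lambda>n. ereal (1 / real n) * ext_ln (measure P (A n)))"
          by (rule exponential_lower_bound_le_limsup)
        also have "\<dots> \<le> - \<alpha> t"
          using assms(9) t(1) unfolding deviation_function_def A_def by blast
        finally have "- ereal ((\<integral>y. ln (f y) \<partial>\<nu>) + \<epsilon>) \<le> - \<alpha> t" by simp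
        then have "\<alpha> t \<le> ereal ((\<integral>y. ln (f y) \<partial>\<nu>) + \<epsilon>)"
          unfolding ereal_minus_le_minus .
        then show ?thesis unfolding plus_ereal.simps .
      qed
      then show ?thesis
        unfolding H by (rule ereal_le_epsilon2)
    qed simp
  qed
qed

end
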